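(* Let $d,m$ be positive integers and let $K \subset (\Delta_{m-1})^{*2}_\Delta$ be a $\mathbb{Z}/2$-equivariant subcomplex. If there is a continuous $\mathbb{Z}/2$-equivariant map $f\colon (\Delta_{m-1})^{*2}_\Delta \to \mathbb{R}^d$ with $K = f^{-1}(0)$, then $K$ is Fan for $S^d$.
   Context: $(\Delta_{m-1})^{*2}_\Delta = \{x\in\mathbb{R}^m \mid \sum_i |x_i| = 1\}$ is the boundary of the $m$-dimensional crosspolytope, a simplicial complex with vertices $\pm e_1,\dots,\pm e_m$; its faces are $\operatorname{conv}(\{e_i\mid i\in\sigma\}\cup\{-e_i\mid i\in\tau\})$ for disjoint $\sigma,\tau\subset[m]$, written $\sigma\cup(-\tau)$. It carries the $\mathbb{Z}/2$-action $x\mapsto -x$ (also on $\mathbb{R}^d$), and a $\mathbb{Z}/2$-equivariant subcomplex is a subcomplex invariant under this action. Such $K$ is called Fan for $S^d$ if for all closed sets $A_1,\dots,A_m\subset S^d$ with $A_i\cap(-A_i)=\emptyset$ for all $i$ and $\bigcup_i A_i\cup\bigcup_i(-A_i)=S^d$, there are disjoint $\sigma,\tau\subset[m]$ such that $\sigma\cup(-\tau)$ is a face of $K$ and $\bigcap_{i\in\sigma}A_i\cap\bigcap_{i\in\tau}(-A_i)\neq\emptyset$. *)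

theory Defs
  imports "HOL-Analysis.Analysis"
begin

definition crosspolytope_boundary :: "(real ^ 'm) set" where
  "crosspolytope_boundary = {x. (\<Sum>i\<in>UNIV. \<bar>x $ i\<bar>) = 1}"

definition crosspolytope_face :: "'m set \<Rightarrow> 'm set \<Rightarrow> (real ^ 'm) set" where
  "crosspolytope_face \<sigma> \<tau> =
     convex hull ((\<lambda>i. axis i 1) ` \<sigma> \<union> (\<lambda>i. - axis i 1) ` \<tau>)"

text \<open>As in the library notion \<^const>\<open>simplicial_complex\<close>, a complex is the set of
  its closed geometric simplices, the empty simplex included; its underlying space is
  the union of that set.\<close>

definition crosspolytope_complex :: "(real ^ 'm) set set" where
  "crosspolytope_complex = {crosspolytope_face \<sigma> \<tau> |\<sigma> \<tau>. \<sigma> \<inter> \<tau> = {}}"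

definition subcomplex_of :: "'a::real_vector set set \<Rightarrow> 'a set set \<Rightarrow> bool" where
  "subcomplex_of K L \<longleftrightarrow> K \<subseteq> L \<and> (\<forall>S\<in>K. \<forall>F. F face_of S \<longrightarrow> F \<in> K)"

definition antipodal_complex :: "'a::real_vector set set \<Rightarrow> bool" where
  "antipodal_complex K \<longleftrightarrow> (\<forall>S\<in>K. uminus ` S \<in> K)"

text \<open>The face \<open>\<sigma> \<union> (-\<tau>)\<close> must be a nonempty simplex: for \<open>\<sigma> = \<tau> = {}\<close> the intersection
  below is over an empty family, and the condition would hold trivially.\<close>

definition fan_for :: "(real ^ 'm) set set \<Rightarrow> 'a::real_normed_vector set \<Rightarrow> bool" where
  "fan_for K S \<longleftrightarrow>
     (\<forall>A :: 'm \<Rightarrow> 'a set.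
        (\<forall>i. closedin (top_of_set S) (A i)) \<longrightarrow>
        (\<forall>i. A i \<inter> uminus ` A i = {}) \<longrightarrow>
        (\<Union>i. A i) \<union> (\<Union>i. uminus ` A i) = S \<longrightarrow>
        (\<exists>\<sigma> \<tau>. \<sigma> \<inter> \<tau> = {} \<and> \<sigma> \<union> \<tau> \<noteq> {} \<and> crosspolytope_face \<sigma> \<tau> \<in> K \<and>
           (\<Inter>i\<in>\<sigma>. A i) \<inter> (\<Inter>i\<in>\<tau>. uminus ` A i) \<noteq> {}))"

end

theory Submission
  imports Defs "HOL-Homology.Homology"
begin

text \<open>Given a covering by the \<open>\<plusminus>A\<^sub>i\<close>, the functions \<open>max 0 (e - dist x A\<^sub>i) - max 0 (e - dist x (-A\<^sub>i))\<close>,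
  normalised in the 1-norm, form an odd map \<open>G\<close> from the sphere to the boundary of the
  crosspolytope. By the Borsuk-Ulam theorem \<open>f \<circ> G\<close> has a zero \<open>x\<close>, so the face spanned by the
  support of \<open>G x\<close> lies in \<open>K\<close>; if \<open>e\<close> is small enough, compactness yields a common point of the
  sets \<open>\<plusminus>A\<^sub>i\<close> selected by that support.

  Borsuk-Ulam: let \<open>T\<close> be the antipodal map. There are chains \<open>h\<^sub>p\<close> in the upper hemisphere of the
  \<open>p\<close>-sphere with \<open>\<partial>h\<^bsub>p+1\<^esub> = z\<^sub>p := h\<^sub>p + (-1)\<^bsup>p+1\<^esup> T h\<^sub>p\<close>, and the class of the cycle \<open>z\<^sub>p\<close> in the
  \<open>p\<close>-th homology of the \<open>p\<close>-sphere is not divisible by 2. For an odd map \<open>g\<close> from the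
  \<open>(q+1)\<close>-sphere to the \<open>q\<close>-sphere, an equivariant chain homotopy between \<open>h\<close> and \<open>g h\<close>, built up
  to dimension \<open>q\<close>, shows that \<open>z\<^sub>q\<close> is homologous to \<open>-(z \<plusminus> T z)\<close> for some cycle \<open>z\<close>. Since \<open>T\<close>
  has degree \<open>\<plusminus>1\<close>, this class is divisible by 2, a contradiction.\<close>

section \<open>Hemisphere chains\<close>

definition antipode :: "(nat \<Rightarrow> real) \<Rightarrow> nat \<Rightarrow> real" where
  "antipode x = (\<lambda>i. - x i)"

text \<open>This is the action on chains of \<open>1 + e T\<close> in the group ring of Z/2, where
  \<open>T\<close> is induced by the antipodal map. It is used with \<open>e\<close> equal to 1 or
  -1.\<close>

definition signed_double :: "int \<Rightarrow> nat \<Rightarrow> (nat \<Rightarrow> real) chain \<Rightarrow> (nat \<Rightarrow> real) chain" where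
  "signed_double e p c = c + frag_cmul e (chain_map p antipode c)"

text \<open>In dimension 0 the coefficient sum must vanish; it is expressed by pushing the chain to a point.\<close>

definition reduced_cycle :: "nat \<Rightarrow> 'a topology \<Rightarrow> 'a chain \<Rightarrow> bool" where
  "reduced_cycle p X c \<longleftrightarrow>
     singular_relcycle p X {} c \<and> (p = 0 \<longrightarrow> chain_map p (\<lambda>x. ()) c = 0)"

lemma homologous_rel_set_eq_iff:
  "homologous_rel_set p X S a = homologous_rel_set p X S b \<longleftrightarrow> singular_relboundary p X S (a - b)"
  unfolding homologous_rel_set_eq by (simp add: homologous_rel_def)

lemma antipode_antipode [simp]: "antipode (antipode x) = x"
  by (simp add: antipode_def)

lemma continuous_map_antipode: "continuous_map (nsphere n) (nsphere n) antipode"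
  unfolding nsphere antipode_def
  by (auto simp: continuous_map_in_subtopology continuous_map_componentwise_UNIV
      intro!: continuous_intros continuous_map_from_subtopology continuous_map_product_projection)

lemma chain_map_antipode_antipode:
  assumes "singular_chain p X c"
  shows "chain_map p antipode (chain_map p antipode c) = c"
proof -
  have "chain_map p (antipode \<circ> antipode) c = c"
    using assms by (rule chain_map_id_gen) simp
  then show ?thesis
    by (simp add: chain_map_compose)
qed

lemma signed_double_diff: "signed_double e p (a - b) = signed_double e p a - signed_double e p b"
  using frag_cmul_distrib2[of e "chain_map p antipode (a - b)" "chain_map p antipode b"]
  by (simp add: signed_double_def chain_map_diff)

text \<open>In the group ring, (1 - e T)(1 + e T) = 1 - e^2 T^2 = 0, because \<open>T\<close> is an
  involution.\<close>

lemma signed_double_cancel: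
  assumes "singular_chain p X c" "e * e = 1"
  shows "signed_double (- e) p (signed_double e p c) = 0"
  by (simp add: signed_double_def chain_map_add chain_map_antipode_antipode[OF assms(1)]
      frag_cmul_distrib2 assms(2) flip: frag_cmul_distrib)

lemma singular_chain_signed_double:
  "singular_chain p (nsphere n) c \<Longrightarrow> singular_chain p (nsphere n) (signed_double e p c)"
  unfolding signed_double_def
  by (intro singular_chain_add singular_chain_cmul singular_chain_chain_map[OF _ continuous_map_antipode])

lemma chain_boundary_signed_double:
  assumes "singular_chain p X c"
  shows "chain_boundary p (signed_double e p c) = signed_double e (p - Suc 0) (chain_boundary p c)"
  by (simp add: signed_double_def chain_boundary_add chain_boundary_cmul
      chain_boundary_chain_map[OF assms])

lemma chain_map_signed_double:
  assumes "singular_chain p X c" "\<And>x. x \<in> topspace X \<Longrightarrow> g (antipode x) = antipode (g x)"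
  shows "chain_map p g (signed_double e p c) = signed_double e p (chain_map p g c)"
proof -
  have "chain_map p (g \<circ> antipode) c = chain_map p (antipode \<circ> g) c"
    using assms(1) by (rule chain_map_eq) (simp add: assms(2))
  then show ?thesis
    by (simp add: signed_double_def chain_map_add chain_map_compose)
qed

text \<open>A chain and its antipodal image become equal at a point, so the sign -1 makes them
  cancel. This starts the hemisphere construction in dimension 0.\<close>

lemma chain_map_unit_signed_double:
  "chain_map p (\<lambda>x. ()) (signed_double (- 1) p c) = 0"
proof -
  have "chain_map p (\<lambda>x. ()) (chain_map p antipode c) = chain_map p (\<lambda>x. ()) c"
    using fun_cong[OF chain_map_compose[of p "\<lambda>x. ()" antipode], of c] by (simp add: o_def)
  then show ?thesis
    by (simp add: signed_double_def chain_map_diff)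
qed

lemma singular_chain_nsphere_Suc:
  "singular_chain p (nsphere n) c \<Longrightarrow> singular_chain p (nsphere (Suc n)) c"
  by (metis singular_chain_subtopology subtopology_nsphere_equator)

lemma singular_chain_nsphere_mono:
  assumes "singular_chain p (nsphere m) c" "m \<le> n"
  shows "singular_chain p (nsphere n) c"
  using assms(2,1) by (induction rule: dec_induct) (auto intro: singular_chain_nsphere_Suc)

section \<open>Filling reduced cycles in spheres and hemispheres\<close>

text \<open>In degree 0 the reduced group is the kernel of the map induced by collapsing to a point;
  in positive degrees it is ordinary homology.\<close>

lemma reduced_cycle_carrier:
  assumes "reduced_cycle p X c"
  shows "homologous_rel_set p X {} c \<in> carrier (reduced_homology_group (int p) X)"
proof -
  have c: "singular_relcycle p X {} c"
    using assms by (simp add: reduced_cycle_def)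
  have mem: "homologous_rel_set p X {} c \<in> carrier (homology_group (int p) X)"
    using c by (simp add: carrier_relative_homology_group)
  show ?thesis
  proof (cases "p = 0")
    case True
    then have "chain_map p (\<lambda>x. ()) c = 0"
      using assms by (simp add: reduced_cycle_def)
    moreover have "hom_induced (int p) X {} (discrete_topology {()}) {} (\<lambda>x. ()) (homologous_rel_set p X {} c)
        = homologous_rel_set p (discrete_topology {()}) {} (chain_map p (\<lambda>x. ()) c)"
      by (rule hom_induced_chain_map) (use c in auto)
    ultimately have "hom_induced (int p) X {} (discrete_topology {()}) {} (\<lambda>x. ()) (homologous_rel_set p X {} c)
        = \<one>\<^bsub>homology_group (int p) (discrete_topology {()})\<^esub>"
      by (simp only: one_relative_homology_group homologous_rel_set_eq_relboundary singular_relboundary_0)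
    with mem show ?thesis
      by (simp add: carrier_reduced_homology_group kernel_def)
  next
    case False
    with mem show ?thesis
      by (simp add: un_reduced_homology_group)
  qed
qed

text \<open>The reduced homology of the \<open>n\<close>-sphere vanishes in all degrees other than
  \<open>n\<close>.\<close>

lemma reduced_cycle_nsphere_bounds:
  assumes "reduced_cycle p (nsphere n) c" "p \<noteq> n"
  obtains b where "singular_chain (Suc p) (nsphere n) b" "chain_boundary (Suc p) b = c"
proof -
  have "trivial_group (reduced_homology_group (int p) (nsphere n))"
    using assms(2) by (simp add: trivial_reduced_homology_group_nsphere)
  then have "homologous_rel_set p (nsphere n) {} c = \<one>\<^bsub>homology_group (int p) (nsphere n)\<^esub>"
    using reduced_cycle_carrier[OF assms(1)]
    by (simp add: trivial_group_def one_reduced_homology_group)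
  then have "singular_relboundary p (nsphere n) {} c"
    by (simp add: homologous_rel_set_eq_relboundary)
  then show ?thesis
    using that by (auto simp: singular_boundary)
qed

abbreviation upper_hemisphere :: "nat \<Rightarrow> (nat \<Rightarrow> real) topology" where
  "upper_hemisphere n \<equiv> subtopology (nsphere n) {x. x n \<ge> 0}"

lemma subtopology_upper_hemisphere_equator:
  "subtopology (upper_hemisphere (Suc n)) {x. x (Suc n) = 0} = nsphere n"
proof -
  have "{x. 0 \<le> x (Suc n)} \<inter> {x. x (Suc n) = 0} = {x. x (Suc n) = (0::real)}"
    by auto
  then show ?thesis
    by (simp add: subtopology_nsphere_equator subtopology_subtopology)
qed

text \<open>The connecting map of the pair (upper hemisphere, equator) is onto the reduced homology
  of the equator. This fills \<open>z\<close> up to a boundary in the equator, which is then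
  corrected by a chain there.\<close>

lemma reduced_cycle_bounds_upper_hemisphere:
  assumes "reduced_cycle p (nsphere p) z"
  obtains c where "singular_chain (Suc p) (upper_hemisphere (Suc p)) c" "chain_boundary (Suc p) c = z"
proof -
  let ?U = "upper_hemisphere (Suc p)" and ?E = "{x. x (Suc p) = (0::real)}"
  have "hom_boundary (1 + int p) ?U ?E \<in> iso (relative_homology_group (1 + int p) ?U ?E)
          (reduced_homology_group (int p) (nsphere p))"
    by (rule iso_upper_hemisphere_reduced_homology_group)
  then have "homologous_rel_set p (nsphere p) {} z \<in> 
        hom_boundary (int (Suc p)) ?U ?E ` carrier (relative_homology_group (int (Suc p)) ?U ?E)"
    using reduced_cycle_carrier[OF assms] by (simp add: iso_iff)
  then obtain a where a: "singular_relcycle (Suc p) ?U ?E a" 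
    and "homologous_rel_set p (nsphere p) {} z = hom_boundary (int (Suc p)) ?U ?E (homologous_rel_set (Suc p) ?U ?E a)"
    unfolding carrier_relative_homology_group by auto
  then have "homologous_rel_set p (nsphere p) {} z = homologous_rel_set p (nsphere p) {} (chain_boundary (Suc p) a)"
    using hom_boundary_chain_boundary[OF a] by (simp add: subtopology_upper_hemisphere_equator)
  then have "singular_relboundary p (nsphere p) {} (z - chain_boundary (Suc p) a)"
    by (simp only: homologous_rel_set_eq_iff)
  then obtain b where b: "singular_chain (Suc p) (nsphere p) b"
    and eq: "chain_boundary (Suc p) b = z - chain_boundary (Suc p) a"
    by (auto simp: singular_boundary)
  show thesis
  proof
    have "singular_chain (Suc p) ?U b"
      using b by (metis singular_chain_subtopology subtopology_upper_hemisphere_equator)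
    then show "singular_chain (Suc p) ?U (a + b)"
      using a by (auto simp: singular_relcycle intro: singular_chain_add)
    show "chain_boundary (Suc p) (a + b) = z"
      using eq by (simp add: chain_boundary_add)
  qed
qed

section \<open>Construction of the hemisphere chains\<close>

text \<open>The only point of the 0-dimensional upper hemisphere, as a singular simplex;
  \<open>restrict\<close> appears because singular simplices are extensional functions.\<close>

definition pole_chain :: "(nat \<Rightarrow> real) chain" where
  "pole_chain = frag_of (restrict (\<lambda>t i. if i = 0 then 1 else 0) (standard_simplex 0))"

text \<open>The chains play the role of the upper cells in the antipodally invariant cell structure
  with two cells in each dimension. Fixing \<open>h 0\<close> allows coefficients to be computed in
  dimension 0.\<close>

definition hemisphere_chains :: "(nat \<Rightarrow> (nat \<Rightarrow> real) chain) \<Rightarrow> bool" where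
  "hemisphere_chains h \<longleftrightarrow> h 0 = pole_chain \<and>
     (\<forall>p. singular_chain p (upper_hemisphere p) (h p) \<and>
          chain_boundary (Suc p) (h (Suc p)) = signed_double ((- 1) ^ Suc p) p (h p))"

lemma singular_chain_pole_chain: "singular_chain 0 (upper_hemisphere 0) pole_chain"
  by (auto simp: pole_chain_def singular_chain_of singular_simplex_def continuous_map_in_subtopology
      in_topspace_nsphere)

lemma singular_chain_upper_hemisphere:
  "singular_chain p (upper_hemisphere p) c \<Longrightarrow> singular_chain p (nsphere p) c"
  by (simp add: singular_chain_subtopology)

lemma hemisphere_chains_exist: "\<exists>h. hemisphere_chains h"
proof -
  let ?P = "\<lambda>p c. singular_chain p (upper_hemisphere p) c \<and>
    reduced_cycle p (nsphere p) (signed_double ((- 1) ^ Suc p) p c) \<and> (p = 0 \<longrightarrow> c = pole_chain)"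
  let ?Q = "\<lambda>p c c'. chain_boundary (Suc p) c' = signed_double ((- 1) ^ Suc p) p c"
  have "\<exists>h. \<forall>p. ?P p (h p) \<and> ?Q p (h p) (h (Suc p))"
  proof (rule dependent_nat_choice)
    have "singular_chain 0 (nsphere 0) (signed_double (- 1) 0 pole_chain)"
      by (intro singular_chain_signed_double singular_chain_upper_hemisphere singular_chain_pole_chain)
    then show "\<exists>c. ?P 0 c"
      using singular_chain_pole_chain
      by (auto simp: reduced_cycle_def singular_cycle chain_map_unit_signed_double chain_boundary_def)
  next
    fix c p
    assume P: "?P p c"
    then obtain c' where c': "singular_chain (Suc p) (upper_hemisphere (Suc p)) c'" 
      and bd: "?Q p c c'"
      using reduced_cycle_bounds_upper_hemisphere by metis
    \<comment> \<open>The sign flips from one dimension to the next, so the two signed doubles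
      annihilate each other and the recursion can continue.\<close>
    have "chain_boundary (Suc p) (signed_double ((- 1) ^ Suc (Suc p)) (Suc p) c') =
        signed_double (- ((- 1) ^ Suc p)) p (signed_double ((- 1) ^ Suc p) p c)"
      using chain_boundary_signed_double[OF singular_chain_upper_hemisphere[OF c']] bd by simp
    also have "\<dots> = 0"
      by (rule signed_double_cancel) (use P singular_chain_upper_hemisphere in \<open>auto simp flip: power_mult_distrib\<close>)
    finally have "reduced_cycle (Suc p) (nsphere (Suc p)) (signed_double ((- 1) ^ Suc (Suc p)) (Suc p) c')"
      using singular_chain_signed_double[OF singular_chain_upper_hemisphere[OF c']] by (simp add: reduced_cycle_def singular_cycle)
    with c' bd show "\<exists>c'. ?P (Suc p) c' \<and> ?Q p c c'"
      by blast
  qed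
  then show ?thesis
    unfolding hemisphere_chains_def by blast
qed


section \<open>Non-divisibility of the hemisphere cycle by 2\<close>

lemma singular_boundary_imp_relboundary:
  assumes "singular_relboundary p X {} c"
  shows "singular_relboundary p X S c"
proof -
  obtain d where "singular_chain (Suc p) X d" "chain_boundary (Suc p) d = c"
    using assms unfolding singular_boundary by blast
  then show ?thesis
    unfolding singular_relboundary_def using mod_subset_refl by blast
qed

text \<open>A simplex is connected and the 0-sphere has two points, so every singular 1-simplex is
  constant; its two faces coincide and cancel.\<close>

lemma chain_boundary_nsphere_0:
  assumes "singular_chain (Suc 0) (nsphere 0) b"
  shows "chain_boundary (Suc 0) b = 0"
  using assms unfolding singular_chain_def
proof (induction rule: frag_induction)
  case (one f)
  have f: "continuous_map (subtopology (powertop_real UNIV) (standard_simplex (Suc 0))) (nsphere 0) f"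
    using one by (simp add: singular_simplex_def)
  have mem: "f x 0 \<in> {- 1, 1}" "\<forall>i>0. f x i = 0" if "x \<in> standard_simplex (Suc 0)" for x
    using continuous_map_image_subset_topspace[OF f] that
    by (auto simp: nsphere power2_eq_1_iff)
  have const: "f x = f y" if xy: "x \<in> standard_simplex (Suc 0)" "y \<in> standard_simplex (Suc 0)" for x y
  proof -
    have "continuous_map (subtopology (powertop_real UNIV) (standard_simplex (Suc 0))) euclideanreal (\<lambda>x. f x 0)"
      using continuous_map_compose[OF f continuous_map_nsphere_projection[of 0 0]] by (simp add: o_def)
    moreover have "connectedin (subtopology (powertop_real UNIV) (standard_simplex (Suc 0))) (standard_simplex (Suc 0))"
      using connectedin_standard_simplex[of "Suc 0"] by (simp add: connectedin_subtopology)
    ultimately have "connectedin euclideanreal ((\<lambda>x. f x 0) ` standard_simplex (Suc 0))"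
      by (rule connectedin_continuous_map_image)
    moreover have "finite ((\<lambda>x. f x 0) ` standard_simplex (Suc 0))"
      by (rule finite_subset[of _ "{- 1, 1}"]) (use mem in auto)
    ultimately obtain a where "(\<lambda>x. f x 0) ` standard_simplex (Suc 0) \<subseteq> {a}"
      using connected_finite_iff_sing by (metis connectedin_iff_connected empty_subsetI subset_refl)
    then have "f x 0 = f y 0"
      using xy by blast
    moreover have "f x i = f y i" if "i > 0" for i
      using mem(2)[OF xy(1)] mem(2)[OF xy(2)] that by simp
    ultimately show "f x = f y"
      by (metis ext gr0I)
  qed
  have "singular_face (Suc 0) 0 f = singular_face (Suc 0) (Suc 0) f"
    unfolding singular_face_def
    by (rule restrict_ext) (auto intro!: const simplical_face_in_standard_simplex)
  then show ?case
    by (simp add: chain_boundary_of)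
qed (auto simp: chain_boundary_diff)

text \<open>The composite of \<open>H\<^bsub>q+1\<^esub>(S\<^bsup>q+1\<^esup>) \<rightarrow> H\<^bsub>q+1\<^esub>(S\<^bsup>q+1\<^esup>, L) \<cong> H\<^bsub>q+1\<^esub>(U, S\<^sup>q) \<rightarrow> H\<^sub>q(S\<^sup>q)\<close>, with \<open>U\<close> and \<open>L\<close>
  the upper and lower hemispheres, sends the class of \<open>z\<^bsub>q+1\<^esub>\<close> to that of \<open>z\<^sub>q\<close>, so divisibility by 2
  descends to the 0-sphere, where all boundaries vanish.\<close>

lemma hemisphere_cycle_not_double:
  assumes h: "hemisphere_chains h"
  shows "singular_relcycle q (nsphere q) {} c \<Longrightarrow>
    \<not> homologous_rel q (nsphere q) {} (signed_double ((- 1) ^ Suc q) q (h q)) (c + c)"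
proof (induction q arbitrary: c)
  case 0
  let ?s = "restrict (\<lambda>t i. if i = 0 then 1 else 0) (standard_simplex 0) :: (nat \<Rightarrow> real) \<Rightarrow> nat \<Rightarrow> real"
  have h0: "h 0 = frag_of ?s"
    using h by (simp add: hemisphere_chains_def pole_chain_def)
  show ?case
  proof
    assume "homologous_rel 0 (nsphere 0) {} (signed_double ((- 1) ^ Suc 0) 0 (h 0)) (c + c)"
    then have "signed_double (- 1) 0 (h 0) = c + c"
      by (auto simp: homologous_rel_def singular_boundary chain_boundary_nsphere_0)
    then have "frag_of ?s - frag_of (simplex_map 0 antipode ?s) = c + c"
      by (simp add: h0 signed_double_def)
    \<comment> \<open>Compare coefficients at the pole: 1 on the left, since the antipodal simplex
      is a different one, and an even number on the right.\<close>
    then have "Poly_Mapping.lookup (frag_of ?s - frag_of (simplex_map 0 antipode ?s)) ?s =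
        Poly_Mapping.lookup (c + c) ?s"
      by simp
    moreover have "simplex_map 0 antipode ?s \<noteq> ?s"
    proof
      assume "simplex_map 0 antipode ?s = ?s"
      then have "simplex_map 0 antipode ?s t 0 = ?s t 0" for t
        by simp
      from this[of "\<lambda>j. if j = 0 then 1 else 0"] show False
        by (simp add: simplex_map_def antipode_def standard_simplex_0)
    qed
    ultimately have "(1::int) = 2 * Poly_Mapping.lookup c ?s"
      by (simp add: lookup_minus lookup_add lookup_single when_def)
    then show False
      by presburger
  qed
next
  case (Suc q)
  let ?U = "upper_hemisphere (Suc q)" and ?E = "{x. x (Suc q) = (0::real)}"
    and ?S = "nsphere (Suc q)" and ?L = "{x. x (Suc q) \<le> (0::real)}"
  let ?z = "signed_double ((- 1) ^ Suc (Suc q)) (Suc q) (h (Suc q))"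
  let ?i = "hom_induced (int (Suc q)) ?U ?E ?S ?L id"
  have hU: "singular_chain (Suc q) ?U (h (Suc q))"
    and bd: "chain_boundary (Suc q) (h (Suc q)) = signed_double ((- 1) ^ Suc q) q (h q)"
    and hq: "singular_chain q (nsphere q) (h q)"
    using h singular_chain_upper_hemisphere unfolding hemisphere_chains_def by blast+
  have cid: "continuous_map ?U ?S id"
    by (simp add: continuous_map_from_subtopology)
  have EL: "id \<in> ?E \<rightarrow> ?L"
    by auto
  have rel_id: "?i (homologous_rel_set (Suc q) ?U ?E x) = homologous_rel_set (Suc q) ?S ?L x"
    if "singular_relcycle (Suc q) ?U ?E x" for x
  proof -
    have "chain_map (Suc q) id x = x"
      using that unfolding singular_relcycle by (blast intro: chain_map_ident)
    then show ?thesis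
      using hom_induced_chain_map[OF cid EL that] by simp
  qed
  have iso: "?i \<in> iso (relative_homology_group (int (Suc q)) ?U ?E) (relative_homology_group (int (Suc q)) ?S ?L)"
    by (rule iso_relative_homology_group_upper_hemisphere)
  have hcyc: "singular_relcycle (Suc q) ?U ?E (h (Suc q))"
    using hU singular_chain_signed_double[OF hq]
    by (simp add: singular_relcycle bd subtopology_upper_hemisphere_equator)
  show ?case
  proof
    assume *: "homologous_rel (Suc q) ?S {} ?z (c + c)"
    have "singular_relboundary (Suc q) ?S ?L (?z - (c + c))"
      using * unfolding homologous_rel_def by (rule singular_boundary_imp_relboundary)
    \<comment> \<open>Up to sign the difference is the antipodal image of \<open>h (Suc q)\<close>,
      which lies in the lower hemisphere.\<close>
    moreover have "singular_relboundary (Suc q) ?S ?L (?z - h (Suc q))"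
    proof (rule singular_chain_imp_relboundary)
      have "continuous_map ?U (subtopology ?S ?L) antipode"
        using continuous_map_antipode[of "Suc q"]
        by (auto simp: continuous_map_in_subtopology continuous_map_from_subtopology antipode_def)
      then have "singular_chain (Suc q) (subtopology ?S ?L) (chain_map (Suc q) antipode (h (Suc q)))"
        by (rule singular_chain_chain_map[OF hU])
      then show "singular_chain (Suc q) (subtopology ?S ?L) (?z - h (Suc q))"
        by (simp add: signed_double_def singular_chain_cmul)
    qed
    ultimately have "singular_relboundary (Suc q) ?S ?L ((?z - (c + c)) - (?z - h (Suc q)))"
      by (rule singular_relboundary_diff)
    moreover have "(?z - (c + c)) - (?z - h (Suc q)) = h (Suc q) - (c + c)"
      by (simp del: power_Suc)
    ultimately have 1: "singular_relboundary (Suc q) ?S ?L (h (Suc q) - (c + c))"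
      by (simp only:)
    have "singular_relcycle (Suc q) ?S ?L c"
      using Suc.prems unfolding singular_cycle by (simp add: singular_relcycle)
    then have "homologous_rel_set (Suc q) ?S ?L c \<in> carrier (relative_homology_group (int (Suc q)) ?S ?L)"
      unfolding carrier_relative_homology_group by blast
    \<comment> \<open>Surjectivity of \<open>?i\<close> replaces \<open>c\<close>, modulo the lower
      hemisphere, by a relative cycle \<open>a\<close> of the upper one.\<close>
    then have "homologous_rel_set (Suc q) ?S ?L c \<in> ?i ` carrier (relative_homology_group (int (Suc q)) ?U ?E)"
      using iso by (simp only: iso_iff)
    then obtain a where a: "singular_relcycle (Suc q) ?U ?E a"
      and "homologous_rel_set (Suc q) ?S ?L c = ?i (homologous_rel_set (Suc q) ?U ?E a)"
      unfolding carrier_relative_homology_group by auto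
    then have "homologous_rel_set (Suc q) ?S ?L c = homologous_rel_set (Suc q) ?S ?L a"
      using rel_id by simp
    then have "singular_relboundary (Suc q) ?S ?L (c - a)"
      by (simp only: homologous_rel_set_eq_iff)
    then have "singular_relboundary (Suc q) ?S ?L ((c - a) + (c - a))"
      by (intro singular_relboundary_add)
    from singular_relboundary_add[OF 1 this]
    have 2: "singular_relboundary (Suc q) ?S ?L (h (Suc q) - (a + a))"
      by (simp add: algebra_simps)
    let ?x = "h (Suc q) - (a + a)"
    have x: "singular_relcycle (Suc q) ?U ?E ?x"
      by (intro singular_relcycle_diff singular_relcycle_add hcyc a)
    have inj: "inj_on ?i (carrier (relative_homology_group (int (Suc q)) ?U ?E))"
      using iso by (simp add: iso_iff)
    \<comment> \<open>Injectivity of \<open>?i\<close> turns the relation modulo the lower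
      hemisphere into one in the upper hemisphere modulo the equator.\<close>
    have "homologous_rel_set (Suc q) ?U ?E ?x = homologous_rel_set (Suc q) ?U ?E 0"
    proof (rule inj_onD[OF inj])
      show "?i (homologous_rel_set (Suc q) ?U ?E ?x) = ?i (homologous_rel_set (Suc q) ?U ?E 0)"
        unfolding rel_id[OF x] rel_id[OF singular_relcycle_0]
        using 2 by (simp only: homologous_rel_set_eq_iff diff_zero)
    qed (use x singular_relcycle_0 in \<open>unfold carrier_relative_homology_group, blast+\<close>)
    then have "singular_relboundary (Suc q) ?U ?E ?x"
      by (simp only: homologous_rel_set_eq_iff diff_zero)
    then obtain b e where b: "singular_chain (Suc (Suc q)) ?U b"
      and e: "singular_chain (Suc q) (nsphere q) e" and eq: "chain_boundary (Suc (Suc q)) b + e = ?x"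
      unfolding singular_relboundary subtopology_upper_hemisphere_equator by blast
    \<comment> \<open>Taking boundaries removes \<open>b\<close>. Thus the equatorial chain
      \<open>e\<close> shows that the lower-dimensional cycle is homologous to twice the boundary of
      \<open>a\<close>, against the induction hypothesis.\<close>
    have "chain_boundary (Suc q) e = chain_boundary (Suc q) ?x"
      unfolding eq[symmetric] using chain_boundary_boundary_alt[OF b] by (simp add: chain_boundary_add)
    then have "homologous_rel q (nsphere q) {} (signed_double ((- 1) ^ Suc q) q (h q))
        (chain_boundary (Suc q) a + chain_boundary (Suc q) a)"
      unfolding homologous_rel_def singular_boundary
      using e by (auto simp: chain_boundary_diff chain_boundary_add bd)
    moreover have "singular_relcycle q (nsphere q) {} (chain_boundary (Suc q) a)"
      using a chain_boundary_boundary_alt[of q ?U a]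
      by (simp add: singular_cycle singular_relcycle subtopology_upper_hemisphere_equator)
    ultimately show False
      using Suc.IH by blast
  qed
qed


section \<open>The Borsuk-Ulam theorem\<close>

lemma Brouwer_degree2_antipode: "\<bar>Brouwer_degree2 q antipode\<bar> = 1"
proof (rule Brouwer_degree2_homeomorphic_map)
  have "homeomorphic_maps (nsphere q) (nsphere q) antipode antipode"
    by (simp add: homeomorphic_maps_def continuous_map_antipode)
  then show "homeomorphic_map (nsphere q) (nsphere q) antipode"
    using homeomorphic_map_maps by blast
qed

text \<open>The antipodal map acts on the top reduced homology by its degree; the two disjuncts are
  the degrees 1 and -1.\<close>

lemma antipode_top_homology:
  assumes "reduced_cycle q (nsphere q) z"
  shows "singular_relboundary q (nsphere q) {} (z - chain_map q antipode z) \<or>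
    singular_relboundary q (nsphere q) {} (z + chain_map q antipode z)"
proof -
  let ?G = "reduced_homology_group (int q) (nsphere q)" and ?S = "nsphere q"
  let ?x = "homologous_rel_set q ?S {} z" and ?y = "homologous_rel_set q ?S {} (chain_map q antipode z)"
  interpret group ?G by simp
  have x: "?x \<in> carrier ?G"
    by (rule reduced_cycle_carrier[OF assms])
  have "hom_induced (int q) ?S {} ?S {} antipode ?x = ?y"
    by (rule hom_induced_chain_map) (use assms continuous_map_antipode in \<open>auto simp: reduced_cycle_def\<close>)
  then have y: "?y = ?x [^]\<^bsub>?G\<^esub> Brouwer_degree2 q antipode"
    using Brouwer_degree2[OF x, of antipode] by simp
  have "Brouwer_degree2 q antipode = 1 \<or> Brouwer_degree2 q antipode = - 1"
    using Brouwer_degree2_antipode[of q] by linarith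
  then show ?thesis
  proof
    assume "Brouwer_degree2 q antipode = 1"
    then have "?x = ?y"
      using x y by (simp add: int_pow_1)
    then show ?thesis
      unfolding homologous_rel_set_eq_iff ..
  next
    assume "Brouwer_degree2 q antipode = - 1"
    then have "?y = inv\<^bsub>?G\<^esub> ?x"
      using x y by (simp add: int_pow_neg int_pow_1)
    then have "?x \<otimes>\<^bsub>?G\<^esub> ?y = \<one>\<^bsub>?G\<^esub>"
      using x by simp
    then have "?x \<otimes>\<^bsub>homology_group (int q) ?S\<^esub> ?y = singular_relboundary_set q ?S {}"
      by (simp add: reduced_homology_group_def)
    moreover have "z + chain_map q antipode z \<in> ?x \<otimes>\<^bsub>homology_group (int q) ?S\<^esub> ?y"
      unfolding mult_relative_homology_group using homologous_rel_refl by blast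
    ultimately show ?thesis
      by blast
  qed
qed

lemma minus_one_power_square: "(- 1) ^ p * (- 1) ^ p = (1 :: int)"
  by (simp flip: power_mult_distrib)

text \<open>For \<open>k\<close> = \<open>g h - h\<close>, the chain \<open>c\<close> in degree
  \<open>p\<close> is the value on \<open>h (p - 1)\<close> of an equivariant chain homotopy from
  \<open>h\<close> to \<open>g h\<close>. The displayed cycle is the obstruction to extending it to
  \<open>h p\<close>.\<close>

lemma equivariant_difference_cycle:
  assumes k: "\<And>p. p \<le> q \<Longrightarrow> singular_chain p (nsphere q) (k p)"
    and bd: "\<And>p. p < q \<Longrightarrow> chain_boundary (Suc p) (k (Suc p)) = signed_double ((- 1) ^ Suc p) p (k p)"
    and k0: "chain_map 0 (\<lambda>x. ()) (k 0) = 0"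
    and "p \<le> q"
  shows "\<exists>c. singular_chain p (nsphere q) c \<and>
    reduced_cycle p (nsphere q) (k p - signed_double ((- 1) ^ p) p c)"
  using \<open>p \<le> q\<close>
proof (induction p)
  case 0
  \<comment> \<open>The homotopy starts with \<open>c = 0\<close>, as there is no chain below
    dimension 0.\<close>
  have "signed_double 1 0 0 = 0"
    by (simp add: signed_double_def)
  then show ?case
    using k[of 0] k0
    by (intro exI[of _ 0]) (simp add: reduced_cycle_def singular_cycle chain_boundary_def)
next
  case (Suc p)
  then obtain c where c: "singular_chain p (nsphere q) c"
    and z: "reduced_cycle p (nsphere q) (k p - signed_double ((- 1) ^ p) p c)"
    by auto
  \<comment> \<open>Since \<open>p < q\<close>, the obstruction bounds; its filling \<open>b\<close>
    is the next value of the homotopy.\<close>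
  obtain b where b: "singular_chain (Suc p) (nsphere q) b"
    and bb: "chain_boundary (Suc p) b = k p - signed_double ((- 1) ^ p) p c"
    using reduced_cycle_nsphere_bounds[OF z] Suc.prems by auto
  let ?e = "(- 1) ^ Suc p :: int"
  have "signed_double ?e p (signed_double ((- 1) ^ p) p c) = 0"
    using signed_double_cancel[OF c minus_one_power_square] by simp
  then have "chain_boundary (Suc p) (signed_double ?e (Suc p) b) = signed_double ?e p (k p)"
    using chain_boundary_signed_double[OF b, of ?e] by (simp add: bb signed_double_diff)
  then have "chain_boundary (Suc p) (k (Suc p) - signed_double ?e (Suc p) b) = 0"
    using Suc.prems by (simp add: chain_boundary_diff bd)
  moreover have "singular_chain (Suc p) (nsphere q) (k (Suc p) - signed_double ?e (Suc p) b)"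
    by (intro singular_chain_diff k singular_chain_signed_double b Suc.prems)
  ultimately have "reduced_cycle (Suc p) (nsphere q) (k (Suc p) - signed_double ?e (Suc p) b)"
    by (simp add: reduced_cycle_def singular_cycle)
  with b show ?case
    by blast
qed

theorem no_antipodal_map_nsphere:
  assumes g: "continuous_map (nsphere (Suc q)) (nsphere q) g"
    and odd: "\<And>x. x \<in> topspace (nsphere (Suc q)) \<Longrightarrow> g (antipode x) = antipode (g x)"
  shows False
proof -
  obtain h where h: "hemisphere_chains h"
    using hemisphere_chains_exist by blast
  have hp: "singular_chain p (nsphere n) (h p)" if "p \<le> n" for p n
    using h that singular_chain_upper_hemisphere singular_chain_nsphere_mono
    unfolding hemisphere_chains_def by blast
  have hbd: "chain_boundary (Suc p) (h (Suc p)) = signed_double ((- 1) ^ Suc p) p (h p)" for p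
    using h unfolding hemisphere_chains_def by blast
  \<comment> \<open>Oddness of \<open>g\<close> makes it commute with signed doubling, so
    \<open>g h\<close> obeys the same boundary relations as \<open>h\<close>.\<close>
  have gbd: "chain_boundary (Suc p) (chain_map (Suc p) g (h (Suc p))) =
      signed_double ((- 1) ^ Suc p) p (chain_map p g (h p))" if "p \<le> q" for p
  proof -
    have "chain_map p g (signed_double ((- 1) ^ Suc p) p (h p)) =
        signed_double ((- 1) ^ Suc p) p (chain_map p g (h p))"
      using hp odd that by (intro chain_map_signed_double[where X = "nsphere (Suc q)"]) auto
    then show ?thesis
      using chain_boundary_chain_map[OF hp[of "Suc p" "Suc q"], of g] that by (simp add: hbd)
  qed
  define k where "k p = chain_map p g (h p) - h p" for p
  have k: "singular_chain p (nsphere q) (k p)" if "p \<le> q" for p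
    unfolding k_def using that
    by (intro singular_chain_diff singular_chain_chain_map[OF _ g] hp) auto
  have kbd: "chain_boundary (Suc p) (k (Suc p)) = signed_double ((- 1) ^ Suc p) p (k p)" if "p < q" for p
    using that gbd[of p] by (simp add: k_def chain_boundary_diff hbd signed_double_diff)
  have k0: "chain_map 0 (\<lambda>x. ()) (k 0) = 0"
  proof -
    have "chain_map 0 (\<lambda>x. ()) (chain_map 0 g (h 0)) = chain_map 0 (\<lambda>x. ()) (h 0)"
      using fun_cong[OF chain_map_compose[of 0 "\<lambda>x. ()" g], of "h 0"] by (simp add: o_def)
    then show ?thesis
      by (simp add: k_def chain_map_diff)
  qed
  obtain c where c: "singular_chain q (nsphere q) c"
    and z: "reduced_cycle q (nsphere q) (k q - signed_double ((- 1) ^ q) q c)"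
    using equivariant_difference_cycle[OF k kbd k0 order_refl] by blast
  define z where "z = k q - signed_double ((- 1) ^ q) q c"
  let ?e = "(- 1) ^ Suc q :: int"
  have zcyc: "singular_relcycle q (nsphere q) {} z"
    using z by (simp add: z_def reduced_cycle_def)
  \<comment> \<open>Signed doubling removes the homotopy term and leaves a relation between
    \<open>z\<close>, \<open>h q\<close> and the boundary of \<open>g h\<close> one dimension
    up.\<close>
  have "signed_double ?e q (signed_double ((- 1) ^ q) q c) = 0"
    using signed_double_cancel[OF c minus_one_power_square] by simp
  then have "signed_double ?e q z = signed_double ?e q (k q)"
    by (simp add: z_def signed_double_diff)
  also have "\<dots> = chain_boundary (Suc q) (chain_map (Suc q) g (h (Suc q))) - signed_double ?e q (h q)"
    using gbd[of q] by (simp add: k_def signed_double_diff)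
  finally have eq: "signed_double ?e q (h q) + signed_double ?e q z =
      chain_boundary (Suc q) (chain_map (Suc q) g (h (Suc q)))"
    by simp
  then have bdry: "singular_relboundary q (nsphere q) {} (signed_double ?e q (h q) + signed_double ?e q z)"
    using singular_chain_chain_map[OF hp[of "Suc q" "Suc q"] g] unfolding singular_boundary by auto
  \<comment> \<open>As the antipodal image of \<open>z\<close> is homologous to \<open>z\<close> or
    \<open>-z\<close>, the signed double of \<open>z\<close> is homologous to 0 or to
    \<open>z + z\<close>; accordingly \<open>w\<close> is 0 or \<open>-z\<close>.\<close>
  have "\<exists>w. singular_relcycle q (nsphere q) {} w \<and>
      singular_relboundary q (nsphere q) {} (signed_double ?e q z + (w + w))"
  proof -
    have e: "signed_double ?e q z = z + chain_map q antipode z \<or>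
        signed_double ?e q z = z - chain_map q antipode z"
      by (cases "even q") (simp_all add: signed_double_def)
    have neg: "z - a + (- z + - z) = - (z + a)" "z + a + (- z + - z) = - (z - a)" for a
      by simp_all
    have "singular_relboundary q (nsphere q) {} (signed_double ?e q z + (0 + 0)) \<or>
        singular_relboundary q (nsphere q) {} (signed_double ?e q z + (- z + - z))"
      using e
    proof
      assume *: "signed_double ?e q z = z + chain_map q antipode z"
      show ?thesis
        unfolding * neg singular_relboundary_minus
        using antipode_top_homology[OF z[folded z_def]] by auto
    next
      assume *: "signed_double ?e q z = z - chain_map q antipode z"
      show ?thesis
        unfolding * neg singular_relboundary_minus
        using antipode_top_homology[OF z[folded z_def]] by auto
    qed
    then show ?thesis
      using zcyc singular_relcycle_0[of q "nsphere q" "{}"] singular_relcycle_minus[of q "nsphere q" "{}" z] by blast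
  qed
  then obtain w where w: "singular_relcycle q (nsphere q) {} w"
    and "singular_relboundary q (nsphere q) {} (signed_double ?e q z + (w + w))"
    by blast
  from singular_relboundary_diff[OF bdry this(2)]
  have "homologous_rel q (nsphere q) {} (signed_double ?e q (h q)) (w + w)"
    by (simp add: homologous_rel_def)
  with hemisphere_cycle_not_double[OF h w] show False
    by blast
qed

text \<open>Without a zero, normalising \<open>f\<close> gives an odd map to the unit sphere one
  dimension lower. The bijections \<open>u\<close> and \<open>v\<close> relabel coordinates by
  natural numbers, as \<open>nsphere\<close> requires.\<close>

lemma Borsuk_Ulam:
  fixes f :: "real ^ 'n \<Rightarrow> real ^ 'd"
  assumes dim: "CARD('n::finite) = CARD('d) + 1"
    and cont: "continuous_on (sphere 0 1) f"
    and odd: "\<And>x. x \<in> sphere 0 1 \<Longrightarrow> f (- x) = - f x"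
  shows "\<exists>x\<in>sphere 0 1. f x = 0"
proof (rule ccontr)
  assume "\<not> ?thesis"
  then have nz: "f x \<noteq> 0" if "x \<in> sphere 0 1" for x
    using that by blast
  \<comment> \<open>The unit spheres of \<open>real ^ 'd\<close> and \<open>real ^ 'n\<close> have
    dimensions \<open>q\<close> and \<open>Suc q\<close>.\<close>
  obtain q where q: "CARD('d) = Suc q"
    by (metis zero_less_card_finite gr0_conv_Suc)
  obtain u :: "'n \<Rightarrow> nat" where u: "bij_betw u UNIV {..Suc q}"
    using dim q finite_same_card_bij[of "UNIV :: 'n set" "{..Suc q}"] by auto
  obtain v :: "nat \<Rightarrow> 'd" where v: "bij_betw v {..q} UNIV"
    using q finite_same_card_bij[of "{..q}" "UNIV :: 'd set"] by auto
  define P :: "(nat \<Rightarrow> real) \<Rightarrow> real ^ 'n" where "P x = (\<chi> i. x (u i))" for x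
  define F where "F x = (\<lambda>i. if i \<le> q then f (P x) $ v i / norm (f (P x)) else 0)" for x
  have norm_P: "P x \<in> sphere 0 1" if "x \<in> topspace (nsphere (Suc q))" for x
  proof -
    have "(\<Sum>i\<in>UNIV. (x (u i))\<^sup>2) = (\<Sum>i\<le>Suc q. (x i)\<^sup>2)"
      using u by (rule sum.reindex_bij_betw)
    also have "\<dots> = 1"
      using that by (simp add: nsphere)
    finally show ?thesis
      by (simp add: P_def norm_vec_def L2_set_def)
  qed
  have contP: "continuous_map (nsphere (Suc q)) (top_of_set (sphere 0 1)) P"
  proof -
    have "continuous_on (topspace (nsphere (Suc q))) P"
      unfolding P_def
      by (intro continuous_on_vec_lambda continuous_on_subset[OF continuous_on_product_coordinates subset_UNIV])
    moreover have "nsphere (Suc q) = top_of_set (topspace (nsphere (Suc q)))"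
      by (simp add: nsphere euclidean_product_topology)
    ultimately have "continuous_map (nsphere (Suc q)) euclidean P"
      by (metis continuous_map_iff_continuous)
    then show ?thesis
      using norm_P by (auto simp: continuous_map_in_subtopology)
  qed
  have "continuous_map (nsphere (Suc q)) (nsphere q) F"
    unfolding nsphere[of q] continuous_map_in_subtopology continuous_map_componentwise_UNIV
  proof (intro conjI allI)
    fix i
    have "continuous_map (top_of_set (sphere 0 1)) euclideanreal (\<lambda>x. if i \<le> q then f x $ v i / norm (f x) else 0)"
      using nz cont by (cases "i \<le> q") (auto intro!: continuous_intros)
    from continuous_map_compose[OF contP this]
    show "continuous_map (nsphere (Suc q)) euclideanreal (\<lambda>x. F x i)"
      by (simp add: F_def o_def)
  next
    have "(\<Sum>i\<le>q. (F x i)\<^sup>2) = 1" if "x \<in> topspace (nsphere (Suc q))" for x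
    proof -
      let ?y = "f (P x)"
      have "(\<Sum>i\<le>q. (F x i)\<^sup>2) = (\<Sum>i\<le>q. (?y $ v i)\<^sup>2 / (norm ?y)\<^sup>2)"
        by (simp add: F_def power_divide)
      also have "\<dots> = (\<Sum>j\<in>UNIV. (?y $ j)\<^sup>2 / (norm ?y)\<^sup>2)"
        by (rule sum.reindex_bij_betw[OF v, of "\<lambda>j. (?y $ j)\<^sup>2 / (norm ?y)\<^sup>2"])
      also have "\<dots> = (norm ?y)\<^sup>2 / (norm ?y)\<^sup>2"
        unfolding sum_divide_distrib[symmetric] by (simp add: norm_vec_def L2_set_def sum_nonneg)
      finally show ?thesis
        using nz[OF norm_P[OF that]] by simp
    qed
    then show "F \<in> topspace (nsphere (Suc q)) \<rightarrow> {x. (\<Sum>i\<le>q. (x i)\<^sup>2) = 1 \<and> (\<forall>i>q. x i = 0)}"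
      by (auto simp: F_def)
  qed
  moreover have "F (antipode x) = antipode (F x)" if "x \<in> topspace (nsphere (Suc q))" for x
  proof -
    have "P (antipode x) = - P x"
      by (simp add: P_def antipode_def vec_eq_iff)
    then have "f (P (antipode x)) = - f (P x)"
      using odd[OF norm_P[OF that]] by simp
    then show ?thesis
      by (auto simp: F_def antipode_def)
  qed
  ultimately show False
    by (rule no_antipodal_map_nsphere)
qed

section \<open>Faces of the crosspolytope and coverings of the sphere\<close>

text \<open>A coordinate half-space is convex, so it suffices to check the vertices.\<close>

lemma crosspolytope_face_signs:
  assumes "y \<in> crosspolytope_face \<sigma> \<tau>"
  shows "i \<notin> \<sigma> \<Longrightarrow> y $ i \<le> 0" "i \<notin> \<tau> \<Longrightarrow> y $ i \<ge> 0"
proof -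
  have "crosspolytope_face \<sigma> \<tau> \<subseteq> {y. y $ i \<le> 0}" if "i \<notin> \<sigma>"
    unfolding crosspolytope_face_def
  proof (rule hull_minimal)
    show "convex {y :: real ^ 'a. y $ i \<le> 0}"
      using convex_halfspace_le[of "axis i 1 :: real ^ 'a" 0] by (simp add: inner_axis')
  qed (use that in \<open>auto simp: axis_def\<close>)
  then show "i \<notin> \<sigma> \<Longrightarrow> y $ i \<le> 0"
    using assms by auto
  have "crosspolytope_face \<sigma> \<tau> \<subseteq> {y. y $ i \<ge> 0}" if "i \<notin> \<tau>"
    unfolding crosspolytope_face_def
  proof (rule hull_minimal)
    show "convex {y :: real ^ 'a. y $ i \<ge> 0}"
      using convex_halfspace_ge[of 0 "axis i 1 :: real ^ 'a"] by (simp add: inner_axis')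
  qed (use that in \<open>auto simp: axis_def\<close>)
  then show "i \<notin> \<tau> \<Longrightarrow> y $ i \<ge> 0"
    using assms by auto
qed

text \<open>Disjointness excludes antipodal pairs of vertices, so the vertices are orthogonal and
  nonzero, hence affinely independent. Hulls of subsets of such a set are faces.\<close>

lemma crosspolytope_face_face_of:
  assumes "\<sigma>' \<inter> \<tau>' = {}" "\<sigma> \<subseteq> \<sigma>'" "\<tau> \<subseteq> \<tau>'"
  shows "crosspolytope_face \<sigma> \<tau> face_of (crosspolytope_face \<sigma>' \<tau>' :: (real ^ 'm) set)"
proof -
  let ?V = "\<lambda>\<sigma> \<tau>. (\<lambda>i. axis i 1) ` \<sigma> \<union> (\<lambda>i. - axis i 1) ` \<tau> :: (real ^ 'm) set"
  have "pairwise orthogonal (?V \<sigma>' \<tau>')"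
    using assms(1) by (auto simp: pairwise_def orthogonal_def inner_axis_axis)
  moreover have "0 \<notin> ?V \<sigma>' \<tau>'"
    by (auto simp: axis_eq_0_iff)
  ultimately have "independent (?V \<sigma>' \<tau>')"
    by (rule pairwise_orthogonal_independent)
  then have "\<not> affine_dependent (?V \<sigma>' \<tau>')"
    using affine_dependent_imp_dependent by blast
  from face_of_convex_hull_affine_independent[OF this, of "convex hull ?V \<sigma> \<tau>"]
  show ?thesis
    unfolding crosspolytope_face_def using assms(2,3) by (metis Un_mono image_mono)
qed

text \<open>The empty set is treated separately because \<open>infdist x {} = 0\<close>.\<close>

definition tent :: "real \<Rightarrow> 'a::metric_space set \<Rightarrow> 'a \<Rightarrow> real" where
  "tent e A x = (if A = {} then 0 else max 0 (e - infdist x A))"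

lemma tent_nonneg: "tent e A x \<ge> 0"
  by (simp add: tent_def)

lemma tent_pos_iff: "tent e A x > 0 \<longleftrightarrow> A \<noteq> {} \<and> infdist x A < e"
  by (auto simp: tent_def)

lemma continuous_on_tent: "continuous_on S (tent e A)"
  unfolding tent_def by (cases "A = {}") (auto intro!: continuous_intros)

lemma infdist_uminus:
  fixes x :: "'a::real_normed_vector"
  shows "infdist (- x) (uminus ` A) = infdist x A"
  by (simp add: infdist_def image_comp dist_minus)

lemma tent_uminus:
  fixes x :: "'a::real_normed_vector"
  shows "tent e (uminus ` A) (- x) = tent e A x"
  by (simp add: tent_def infdist_uminus)

section \<open>Compactness and the choice of the tent width\<close>

text \<open>The sum of the distances is positive on \<open>S\<close> and attains its minimum there;
  at each point some summand is at least the average of that minimum.\<close>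

lemma compact_infdist_bounded_below:
  fixes S :: "'a::euclidean_space set" and B :: "'i \<Rightarrow> 'a set"
  assumes S: "compact S" and fin: "finite I" and ne: "\<And>i. i \<in> I \<Longrightarrow> B i \<noteq> {}"
    and cl: "\<And>i. i \<in> I \<Longrightarrow> closed (B i)" and disj: "S \<inter> (\<Inter>i\<in>I. B i) = {}"
  obtains e where "e > 0" "\<And>x. x \<in> S \<Longrightarrow> \<exists>i\<in>I. infdist x (B i) \<ge> e"
proof (cases "S = {} \<or> I = {}")
  case True
  then show ?thesis
    using disj that[of 1] by auto
next
  case False
  define g where "g x = (\<Sum>i\<in>I. infdist x (B i))" for x
  have "continuous_on S g"
    unfolding g_def by (intro continuous_intros)
  then obtain x0 where x0: "x0 \<in> S" "\<And>x. x \<in> S \<Longrightarrow> g x0 \<le> g x"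
    using continuous_attains_inf[OF S] False by blast
  obtain i where i: "i \<in> I" "x0 \<notin> B i"
    using x0(1) disj by blast
  then have "infdist x0 (B i) > 0"
    using in_closed_iff_infdist_zero[OF cl ne] infdist_nonneg[of x0 "B i"] by (metis less_eq_real_def)
  then have pos: "g x0 > 0"
    unfolding g_def using i(1) fin by (intro sum_pos2[of I i]) (auto simp: infdist_nonneg)
  have card: "card I > 0"
    using fin False by (simp add: card_gt_0_iff)
  show ?thesis
  proof
    show "g x0 / card I > 0"
      using pos card by simp
    fix x assume "x \<in> S"
    show "\<exists>i\<in>I. g x0 / card I \<le> infdist x (B i)"
    proof (rule ccontr)
      assume "\<not> ?thesis"
      then have "infdist x (B i) < g x0 / card I" if "i \<in> I" for i
        using that by (meson not_le)
      then have "g x < (\<Sum>i\<in>I. g x0 / card I)"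
        unfolding g_def[of x] using fin False by (intro sum_strict_mono) blast+
      then show False
        using x0(2)[OF \<open>x \<in> S\<close>] card by simp
    qed
  qed
qed

text \<open>There are finitely many index sets \<open>J\<close>, each with its own admissible width.
  The least of these works for all, since shrinking the width only shrinks the support of a
  tent.\<close>

lemma tent_support_meets:
  fixes S :: "'a::euclidean_space set" and B :: "'i::finite \<Rightarrow> 'a set"
  assumes S: "compact S" and cl: "\<And>i. closed (B i)"
  obtains e where "e > 0" "\<And>x. x \<in> S \<Longrightarrow> \<exists>y\<in>S. \<forall>i. tent e (B i) x > 0 \<longrightarrow> y \<in> B i"
proof -
  have "\<exists>e>0. \<forall>x\<in>S. (\<forall>i\<in>J. tent e (B i) x > 0) \<longrightarrow> S \<inter> (\<Inter>i\<in>J. B i) \<noteq> {}" for J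
  proof (cases "S \<inter> (\<Inter>i\<in>J. B i) \<noteq> {} \<or> (\<exists>i\<in>J. B i = {})")
    case True
    \<comment> \<open>Any width works: either the sets already meet in \<open>S\<close>, or one of
      them is empty and its tent vanishes.\<close>
    then show ?thesis
      by (intro exI[of _ 1]) (auto simp: tent_pos_iff)
  next
    case False
    then obtain e where "e > 0" "\<And>x. x \<in> S \<Longrightarrow> \<exists>i\<in>J. infdist x (B i) \<ge> e"
      using compact_infdist_bounded_below[OF S finite[of J], of B] cl by blast
    then show ?thesis
      by (intro exI[of _ e]) (meson not_le tent_pos_iff)
  qed
  then obtain r where r: "\<And>J. r J > 0"
    "\<And>J x. x \<in> S \<Longrightarrow> (\<And>i. i \<in> J \<Longrightarrow> tent (r J) (B i) x > 0) \<Longrightarrow> S \<inter> (\<Inter>i\<in>J. B i) \<noteq> {}"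
    by metis
  show ?thesis
  proof
    show "Min (range r) > 0"
      using r(1) by (subst Min_gr_iff) auto
    fix x assume x: "x \<in> S"
    let ?J = "{i. tent (Min (range r)) (B i) x > 0}"
    have "Min (range r) \<le> r ?J"
      by simp
    then have "tent (r ?J) (B i) x > 0" if "i \<in> ?J" for i
      using that unfolding tent_pos_iff mem_Collect_eq by linarith
    then have "S \<inter> (\<Inter>i\<in>?J. B i) \<noteq> {}"
      by (rule r(2)[OF x])
    then show "\<exists>y\<in>S. \<forall>i. tent (Min (range r)) (B i) x > 0 \<longrightarrow> y \<in> B i"
      by blast
  qed
qed

text \<open>The signs of \<open>x\<close> place its support inside the vertex set of any simplex of
  \<open>K\<close> containing it, and \<open>K\<close> is closed under faces.\<close>

lemma subcomplex_support_mem: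
  assumes sub: "subcomplex_of K crosspolytope_complex" and x: "x \<in> \<Union>K"
  shows "crosspolytope_face {i. x $ i > 0} {i. x $ i < 0} \<in> K"
proof -
  obtain F where F: "F \<in> K" "x \<in> F"
    using x by blast
  then obtain \<sigma> \<tau> where "F = crosspolytope_face \<sigma> \<tau>" "\<sigma> \<inter> \<tau> = {}"
    using sub by (auto simp: subcomplex_of_def crosspolytope_complex_def)
  moreover from this have "{i. x $ i > 0} \<subseteq> \<sigma>" "{i. x $ i < 0} \<subseteq> \<tau>"
    using crosspolytope_face_signs[of x \<sigma> \<tau>] F(2) by (auto simp: not_less[symmetric])
  ultimately have "crosspolytope_face {i. x $ i > 0} {i. x $ i < 0} face_of F"
    using crosspolytope_face_face_of by blast
  with F(1) show ?thesis
    using sub by (auto simp: subcomplex_of_def)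
qed

section \<open>The Fan property\<close>

theorem theorem7p1:
  fixes K :: "(real ^ 'm) set set"
    and f :: "real ^ 'm \<Rightarrow> real ^ 'd"
  assumes dim: "CARD('n::finite) = CARD('d) + 1"
    and sub: "subcomplex_of K crosspolytope_complex"
    and inv: "antipodal_complex K"
    and cont: "continuous_on crosspolytope_boundary f"
    and equiv: "\<forall>x\<in>crosspolytope_boundary. f (- x) = - f x"
    and zeros: "\<Union>K = {x \<in> crosspolytope_boundary. f x = 0}"
  shows "fan_for K (sphere (0 :: real ^ 'n) 1)"
  unfolding fan_for_def
proof (intro allI impI)
  let ?S = "sphere (0 :: real ^ 'n) 1"
  fix A :: "'m \<Rightarrow> (real ^ 'n) set"
  assume clA: "\<forall>i. closedin (top_of_set ?S) (A i)" and disj: "\<forall>i. A i \<inter> uminus ` A i = {}"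
    and cover: "(\<Union>i. A i) \<union> (\<Union>i. uminus ` A i) = ?S"
  have cl: "closed (A i)" for i
    by (rule closedin_closed_trans[OF clA[rule_format] closed_sphere])
  \<comment> \<open>All the sets \<open>A i\<close> and their negatives form one family, so that a
    single width \<open>e\<close> serves every sign pattern.\<close>
  define B where "B = (\<lambda>(i, b). if b then A i else uminus ` A i)"
  have "closed (B j)" for j
    using cl closed_negations[OF cl] by (auto simp: B_def split: prod.splits)
  then obtain e where e: "e > 0" and meets:
    "\<And>x. x \<in> ?S \<Longrightarrow> \<exists>y\<in>?S. \<forall>j. tent e (B j) x > 0 \<longrightarrow> y \<in> B j"
    using tent_support_meets[OF compact_sphere, of B 0 1] by blast
  define w where "w x = (\<chi> i. tent e (A i) x - tent e (uminus ` A i) x)" for x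
  have w_odd: "w (- x) = - w x" for x
  proof -
    have "tent e (A i) (- x) = tent e (uminus ` A i) x" for i
      using tent_uminus[of e "uminus ` A i" x] by (simp add: image_comp)
    then show ?thesis
      by (simp add: w_def vec_eq_iff tent_uminus)
  qed
  have w_cont: "continuous_on ?S w"
    unfolding w_def by (intro continuous_on_vec_lambda continuous_intros continuous_on_tent)
  have w_supp: "\<exists>y\<in>?S. \<forall>i. (w x $ i > 0 \<longrightarrow> y \<in> A i) \<and> (w x $ i < 0 \<longrightarrow> y \<in> uminus ` A i)"
    and w_ne: "w x \<noteq> 0" if x: "x \<in> ?S" for x
  proof -
    obtain y where "y \<in> ?S" and y: "\<And>j. tent e (B j) x > 0 \<Longrightarrow> y \<in> B j"
      using meets[OF x] by blast
    have yA: "y \<in> A i" if "tent e (A i) x > 0" for i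
      using y[of "(i, True)"] that by (simp add: B_def)
    have yB: "y \<in> uminus ` A i" if "tent e (uminus ` A i) x > 0" for i
      using y[of "(i, False)"] that by (simp add: B_def)
    have pos: "tent e (A i) x > 0" if "w x $ i > 0" for i
      using that tent_nonneg[of e "uminus ` A i" x] by (simp add: w_def)
    have neg: "tent e (uminus ` A i) x > 0" if "w x $ i < 0" for i
      using that tent_nonneg[of e "A i" x] by (simp add: w_def)
    show "\<exists>y\<in>?S. \<forall>i. (w x $ i > 0 \<longrightarrow> y \<in> A i) \<and> (w x $ i < 0 \<longrightarrow> y \<in> uminus ` A i)"
      using \<open>y \<in> ?S\<close> yA yB pos neg by blast
    obtain i where "x \<in> A i \<or> x \<in> uminus ` A i"
      using cover x by blast
    then have "tent e (A i) x > 0 \<or> tent e (uminus ` A i) x > 0"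
      using e unfolding tent_pos_iff by (metis empty_iff infdist_zero)
    \<comment> \<open>If both tents were positive, \<open>y\<close> would lie in \<open>A i\<close>
      and in its negative. Hence the two tents cannot cancel in \<open>w x\<close>.\<close>
    moreover have "\<not> (tent e (A i) x > 0 \<and> tent e (uminus ` A i) x > 0)"
      using yA yB disj by blast
    ultimately have "w x $ i \<noteq> 0"
      using tent_nonneg[of e "A i" x] tent_nonneg[of e "uminus ` A i" x] by (auto simp: w_def)
    then show "w x \<noteq> 0"
      by auto
  qed
  define s where "s x = (\<Sum>i\<in>UNIV. \<bar>w x $ i\<bar>)" for x
  have s_pos: "s x > 0" if x: "x \<in> ?S" for x
  proof -
    obtain i where "w x $ i \<noteq> 0"
      using w_ne[OF x] by (auto simp: vec_eq_iff)
    then show ?thesis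
      unfolding s_def by (intro sum_pos2[of UNIV i]) auto
  qed
  define G where "G x = w x /\<^sub>R s x" for x
  have s_even: "s (- x) = s x" for x
    by (simp add: s_def w_odd)
  have G_odd: "G (- x) = - G x" for x
    by (simp add: G_def w_odd s_even)
  have G_mem: "G x \<in> crosspolytope_boundary" if "x \<in> ?S" for x
  proof -
    have "(\<Sum>i\<in>UNIV. \<bar>G x $ i\<bar>) = s x / s x"
      using s_pos[OF that] by (simp add: G_def abs_mult s_def divide_inverse_commute flip: sum_distrib_left)
    then show ?thesis
      using s_pos[OF that] by (simp add: crosspolytope_boundary_def)
  qed
  have "continuous_on ?S s"
    unfolding s_def by (intro continuous_intros w_cont)
  then have "continuous_on ?S G"
    unfolding G_def using s_pos w_cont by (intro continuous_intros) (auto simp: less_le)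
  then have "continuous_on ?S (f \<circ> G)"
    using cont G_mem by (intro continuous_on_compose continuous_on_subset[OF cont]) auto
  moreover have "(f \<circ> G) (- x) = - (f \<circ> G) x" if "x \<in> ?S" for x
    using G_mem[OF that] equiv by (simp add: G_odd)
  ultimately obtain x where x: "x \<in> ?S" and "(f \<circ> G) x = 0"
    using Borsuk_Ulam[OF dim, of "f \<circ> G"] by blast
  then have "G x \<in> \<Union>K"
    using zeros G_mem by simp
  then have face: "crosspolytope_face {i. G x $ i > 0} {i. G x $ i < 0} \<in> K"
    by (rule subcomplex_support_mem[OF sub])
  \<comment> \<open>Dividing by the positive number \<open>s x\<close> preserves signs, so the face
    found for \<open>G x\<close> is the one selected by \<open>w x\<close>.\<close>
  have sgn: "G x $ i > 0 \<longleftrightarrow> w x $ i > 0" "G x $ i < 0 \<longleftrightarrow> w x $ i < 0" for i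
    using s_pos[OF x] by (simp_all add: G_def zero_less_mult_iff mult_less_0_iff)
  let ?\<sigma> = "{i. w x $ i > 0}" and ?\<tau> = "{i. w x $ i < 0}"
  have "crosspolytope_face ?\<sigma> ?\<tau> \<in> K"
    using face by (simp only: sgn)
  moreover have "?\<sigma> \<inter> ?\<tau> = {}"
    by auto
  moreover have "?\<sigma> \<union> ?\<tau> \<noteq> {}"
    using w_ne[OF x] by (auto simp: vec_eq_iff set_eq_iff linorder_neq_iff)
  moreover have "(\<Inter>i\<in>?\<sigma>. A i) \<inter> (\<Inter>i\<in>?\<tau>. uminus ` A i) \<noteq> {}"
    using w_supp[OF x] by blast
  ultimately show "\<exists>\<sigma> \<tau>. \<sigma> \<inter> \<tau> = {} \<and> \<sigma> \<union> \<tau> \<noteq> {} \<and> crosspolytope_face \<sigma> \<tau> \<in> K \<and>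
      (\<Inter>i\<in>\<sigma>. A i) \<inter> (\<Inter>i\<in>\<tau>. uminus ` A i) \<noteq> {}"
    by (intro exI[of _ ?\<sigma>] exI[of _ ?\<tau>] conjI)
qed

end
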